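(* Let $n$ be a positive integer, $c=\frac14\left(1-\frac{1}{(2n+1)^2}\right)$ and $b\in\mathbb C$, $b\neq 0$. Then the equation $$\frac{dy}{dx}=c\,x\,y^3+y^2$$ has $n$ different "limit cycles", i.e. there are $n$ different local holomorphic solutions $y^j(x)$ at the origin, $j=1,\dots,n$, and paths $s^j$ from $0$ to $b$ in $\mathbb C$, such that each $y^j(x)$, being analytically continued along $s^j$, satisfies $y^j(0)=y^j(b)$.
   Context: All variables are complex; solutions are in general multivalued, and $y^j(b)$ denotes the (finite) value at $b$ of the analytic continuation of the local solution $y^j$ along $s^j$. *)

theory Defs
  imports "HOL-Complex_Analysis.Complex_Analysis"
begin

text \<open>Germs of functions are represented by functions on the whole plane; only their behaviour
  near the base point matters.\<close>

definition same_germ :: "complex \<Rightarrow> (complex \<Rightarrow> complex) \<Rightarrow> (complex \<Rightarrow> complex) \<Rightarrow> bool" where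
  "same_germ a f g \<longleftrightarrow> (\<forall>\<^sub>F z in nhds a. f z = g z)"

definition local_holomorphic_solution ::
    "(complex \<Rightarrow> complex \<Rightarrow> complex) \<Rightarrow> complex \<Rightarrow> (complex \<Rightarrow> complex) \<Rightarrow> bool" where
  "local_holomorphic_solution rhs a y \<longleftrightarrow>
     (\<exists>r>0. y holomorphic_on ball a r \<and>
        (\<forall>x\<in>ball a r. (y has_field_derivative rhs x (y x)) (at x)))"

text \<open>The germ of \<open>f\<close> at the start of \<open>s\<close> can be continued analytically along the whole of \<open>s\<close>,
  up to and including its endpoint, and this results in the germ of \<open>g\<close> at the endpoint.
  The pairs \<open>(F t, D t)\<close> are function elements; neighbouring ones have to agree only as
  germs at points of the path, so \<open>F\<close> may be multivalued where the path crosses itself.\<close>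

definition analytic_continuation_along ::
    "(real \<Rightarrow> complex) \<Rightarrow> (complex \<Rightarrow> complex) \<Rightarrow> (complex \<Rightarrow> complex) \<Rightarrow> bool" where
  "analytic_continuation_along s f g \<longleftrightarrow>
     (\<exists>F D.
        (\<forall>t\<in>{0..1}. open (D t) \<and> connected (D t) \<and> s t \<in> D t \<and> F t holomorphic_on D t) \<and>
        (\<forall>t\<in>{0..1}. \<exists>\<delta>>0. \<forall>t'\<in>{0..1}. \<bar>t' - t\<bar> < \<delta> \<longrightarrow>
            s t' \<in> D t \<and> same_germ (s t') (F t') (F t)) \<and>
        same_germ (pathstart s) (F 0) f \<and>
        same_germ (pathfinish s) (F 1) g)"

end

theory Submission
  imports Defs "HOL-Computational_Algebra.Fundamental_Theorem_Algebra"
begin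

text \<open>With \<open>w = -1/y\<close> the equation becomes \<open>w w' = w - c x\<close>, i.e. the linear system
  \<open>dx/d\<tau> = w\<close>, \<open>dw/d\<tau> = w - c x\<close>, whose eigenvalues are \<open>n / (2n+1)\<close> and \<open>(n+1) / (2n+1)\<close> by the
  choice of \<open>c\<close>. In terms of \<open>T = exp (\<tau> / (2n+1))\<close> the solutions whose parameter
  \<open>T = 1\<close> corresponds to \<open>x = 0\<close> are \<open>x = A T^n (T - 1)\<close>,
  \<open>w = A T^n ((n+1) T - n) / (2n+1)\<close>. The values of \<open>y\<close> at the parameters \<open>1\<close> and \<open>T\<close> coincide
  iff \<open>T^n ((n+1) T - n) = 1\<close>, an equation with \<open>n\<close> distinct roots \<open>T \<noteq> 1\<close>; for each of them \<open>A\<close> is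
  determined by \<open>x = b\<close>. The path is the image under \<open>x\<close> of any path in the \<open>T\<close>-plane from \<open>1\<close>
  to the root that avoids the critical points \<open>0\<close> and \<open>n / (n+1)\<close> of \<open>x\<close>.\<close>

section \<open>Analytic continuation of parametrized functions\<close>

text \<open>Near a noncritical point \<open>X\<close> is injective, so \<open>F\<close> can be taken
  as \<open>Y\<close> composed with the local inverse of \<open>X\<close>; the chain rule gives its
  derivative.\<close>

lemma local_factor_through:
  fixes X Y :: "complex \<Rightarrow> complex"
  assumes "open U" "a \<in> U" and X: "X holomorphic_on U" and Y: "Y holomorphic_on U"
    and dX: "deriv X a \<noteq> 0"
  obtains r F where "r > 0" "ball a r \<subseteq> U" "open (X ` ball a r)"
    "\<And>T. T \<in> ball a r \<Longrightarrow> F (X T) = Y T"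
    "\<And>T. T \<in> ball a r \<Longrightarrow> (F has_field_derivative deriv Y T / deriv X T) (at (X T))"
proof -
  obtain r where r: "r > 0" "ball a r \<subseteq> U" "inj_on X (ball a r)"
    using has_complex_derivative_locally_injective[OF X \<open>a \<in> U\<close> \<open>open U\<close> dX] by blast
  have Xr: "X holomorphic_on ball a r" using X r(2) by (rule holomorphic_on_subset)
  obtain g where g: "g holomorphic_on (X ` ball a r)"
      "\<And>z. z \<in> ball a r \<Longrightarrow> deriv X z * deriv g (X z) = 1"
      "\<And>z. z \<in> ball a r \<Longrightarrow> g (X z) = z"
    using holomorphic_has_inverse[OF Xr open_ball r(3)] by blast
  have op: "open (X ` ball a r)" by (rule open_mapping_thm3[OF Xr open_ball r(3)])
  have "((\<lambda>z. Y (g z)) has_field_derivative deriv Y T / deriv X T) (at (X T))"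
    if T: "T \<in> ball a r" for T
  proof -
    have 1: "(g has_field_derivative deriv g (X T)) (at (X T))"
      using holomorphic_derivI[OF g(1) op] T by blast
    have 2: "(Y has_field_derivative deriv Y T) (at (g (X T)))"
      using holomorphic_derivI[OF Y \<open>open U\<close>] T r(2) g(3) by auto
    have "deriv g (X T) = 1 / deriv X T"
      using g(2)[OF T] by (metis mult_eq_0_iff nonzero_eq_divide_eq mult.commute zero_neq_one)
    then show ?thesis using DERIV_chain2[OF 2 1] by simp
  qed
  with r op g(3) show ?thesis by (intro that[of r "\<lambda>z. Y (g z)"]) auto
qed

text \<open>The function element at time \<open>t\<close> is \<open>Y\<close> after the branch of
  the inverse of \<open>X\<close> near \<open>\<gamma> t\<close>, so self-crossings of the image
  path do no harm. The formulas for the initial germ and the final value serve to verify a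
  differential equation and to compare the endpoints.\<close>

lemma analytic_continuation_along_compose:
  fixes X Y :: "complex \<Rightarrow> complex"
  assumes U: "open U" and X: "X holomorphic_on U" and Y: "Y holomorphic_on U"
    and dX: "\<And>T. T \<in> U \<Longrightarrow> deriv X T \<noteq> 0"
    and \<gamma>: "path \<gamma>" "path_image \<gamma> \<subseteq> U"
  obtains f g r where "analytic_continuation_along (X \<circ> \<gamma>) f g"
    "r > 0" "ball (pathstart \<gamma>) r \<subseteq> U" "open (X ` ball (pathstart \<gamma>) r)"
    "\<And>T. T \<in> ball (pathstart \<gamma>) r \<Longrightarrow> f (X T) = Y T"
    "\<And>T. T \<in> ball (pathstart \<gamma>) r \<Longrightarrow>
        (f has_field_derivative deriv Y T / deriv X T) (at (X T))"
    "g (X (pathfinish \<gamma>)) = Y (pathfinish \<gamma>)"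
proof -
  have "\<forall>t\<in>{0..1}. \<exists>r F. r > 0 \<and> ball (\<gamma> t) r \<subseteq> U \<and> open (X ` ball (\<gamma> t) r) \<and>
      (\<forall>T\<in>ball (\<gamma> t) r. F (X T) = Y T \<and>
         (F has_field_derivative deriv Y T / deriv X T) (at (X T)))"
  proof
    fix t :: real assume "t \<in> {0..1}"
    then have "\<gamma> t \<in> U" using \<gamma>(2) by (auto simp: path_image_def)
    then show "\<exists>r F. r > 0 \<and> ball (\<gamma> t) r \<subseteq> U \<and> open (X ` ball (\<gamma> t) r) \<and>
      (\<forall>T\<in>ball (\<gamma> t) r. F (X T) = Y T \<and>
         (F has_field_derivative deriv Y T / deriv X T) (at (X T)))"
      using local_factor_through[OF U _ X Y dX, of "\<gamma> t"] by metis
  qed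
  then obtain r F where rF: "\<And>t. t \<in> {0..1} \<Longrightarrow> r t > 0 \<and> ball (\<gamma> t) (r t) \<subseteq> U \<and>
      open (X ` ball (\<gamma> t) (r t)) \<and> (\<forall>T\<in>ball (\<gamma> t) (r t). F t (X T) = Y T \<and>
         (F t has_field_derivative deriv Y T / deriv X T) (at (X T)))"
    by metis
  define D where "D t = X ` ball (\<gamma> t) (r t)" for t
  have agree: "\<exists>\<delta>>0. \<forall>t'\<in>{0..1}. \<bar>t' - t\<bar> < \<delta> \<longrightarrow>
      (X \<circ> \<gamma>) t' \<in> D t \<and> same_germ ((X \<circ> \<gamma>) t') (F t') (F t)" if t: "t \<in> {0..1}" for t
  proof -
    have "continuous_on {0..1} \<gamma>" using \<gamma>(1) by (simp add: path_def)
    then obtain \<delta> where \<delta>: "\<delta> > 0" "\<And>t'. t' \<in> {0..1} \<Longrightarrow> \<bar>t' - t\<bar> < \<delta> \<Longrightarrow> dist (\<gamma> t') (\<gamma> t) < r t"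
      using rF[OF t] t unfolding continuous_on_iff dist_real_def by metis
    have "X (\<gamma> t') \<in> D t \<and> same_germ (X (\<gamma> t')) (F t') (F t)"
      if t': "t' \<in> {0..1}" "\<bar>t' - t\<bar> < \<delta>" for t'
    proof -
      have in_t: "\<gamma> t' \<in> ball (\<gamma> t) (r t)" using \<delta>(2)[OF t'] by (simp add: dist_commute)
      have in_t': "\<gamma> t' \<in> ball (\<gamma> t') (r t')" using rF[OF t'(1)] by simp
      obtain e where e: "e > 0" "ball (\<gamma> t') e \<subseteq> ball (\<gamma> t) (r t) \<inter> ball (\<gamma> t') (r t')"
        using in_t in_t' open_contains_ball[of "ball (\<gamma> t) (r t) \<inter> ball (\<gamma> t') (r t')"] by blast
      let ?V = "ball (\<gamma> t') e"
      have VU: "?V \<subseteq> U" using e(2) rF[OF t] by blast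
      have "\<gamma> t' \<in> U" using VU \<open>e > 0\<close> by auto
      \<comment> \<open>The smaller ball has an open image, a neighbourhood of
        \<open>X (\<gamma> t')\<close>. There both elements take the value \<open>Y T\<close> at
        \<open>X T\<close>, so their germs agree.\<close>
      then obtain q where q: "q > 0" "ball (\<gamma> t') q \<subseteq> ?V" "open (X ` ball (\<gamma> t') q)"
        using local_factor_through[OF open_ball _ holomorphic_on_subset[OF X VU]
            holomorphic_on_subset[OF Y VU] dX] \<open>e > 0\<close> by (metis centre_in_ball)
      have "F t' z = F t z" if "z \<in> X ` ball (\<gamma> t') q" for z
      proof -
        obtain T where T: "T \<in> ball (\<gamma> t') q" "z = X T" using \<open>z \<in> X ` ball (\<gamma> t') q\<close> by blast
        then have "T \<in> ball (\<gamma> t) (r t)" "T \<in> ball (\<gamma> t') (r t')" using q(2) e(2) by blast+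
        then show ?thesis using rF[OF t] rF[OF t'(1)] T(2) by auto
      qed
      then have "same_germ (X (\<gamma> t')) (F t') (F t)"
        unfolding same_germ_def eventually_nhds using q(1,3) centre_in_ball by blast
      then show ?thesis using in_t by (auto simp: D_def)
    qed
    then show ?thesis using \<delta>(1) by auto
  qed
  have "open (D t) \<and> connected (D t) \<and> (X \<circ> \<gamma>) t \<in> D t \<and> F t holomorphic_on D t"
    if t: "t \<in> {0..1}" for t
  proof -
    note R = rF[OF t]
    have "continuous_on (ball (\<gamma> t) (r t)) X"
      using R X by (meson holomorphic_on_imp_continuous_on holomorphic_on_subset)
    then have "connected (D t)" unfolding D_def by (intro connected_continuous_image) auto
    moreover have "F t holomorphic_on D t"
      using R unfolding D_def holomorphic_on_def field_differentiable_def
      by (blast intro: has_field_derivative_at_within)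
    ultimately show ?thesis using R by (auto simp: D_def)
  qed
  then have "analytic_continuation_along (X \<circ> \<gamma>) (F 0) (F 1)"
    unfolding analytic_continuation_along_def
    using agree by (intro exI[of _ F] exI[of _ D]) (auto simp: same_germ_def)
  then show ?thesis
    using rF[of 0] rF[of 1] by (intro that[of "F 0" "F 1" "r 0"]) (auto simp: pathstart_def pathfinish_def)
qed

section \<open>Roots of the parameter equation\<close>

text \<open>A polynomial of degree \<open>n + 1\<close> has this many roots unless one is multiple.
  Its only nonzero critical point is real, and there the left-hand side is at most 0, hence not 1.
  The trivial root 1 is included in the count.\<close>

lemma card_parameter_equation_roots:
  assumes "n \<ge> 1"
  shows "card {T::complex. T ^ n * ((of_nat n + 1) * T - of_nat n) = 1} = Suc n"
proof -
  define p :: "complex poly" where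
    "p = monom (of_nat n + 1) (Suc n) - monom (of_nat n) n - 1"
  have poly_p: "poly p T = T ^ n * ((of_nat n + 1) * T - of_nat n) - 1" for T
    by (simp add: p_def poly_monom algebra_simps)
  have n1: "(of_nat n + 1 :: complex) \<noteq> 0"
    by (metis of_nat_Suc of_nat_eq_0_iff nat.simps(3) add.commute)
  have deg: "degree p = Suc n"
  proof (rule antisym)
    show "degree p \<le> Suc n"
      unfolding p_def by (intro degree_diff_le order.trans[OF degree_monom_le]) auto
    have "coeff p (Suc n) \<noteq> 0" using n1 assms by (simp add: p_def)
    then show "Suc n \<le> degree p" by (rule le_degree)
  qed
  have "rsquarefree p"
    unfolding rsquarefree_roots
  proof (intro allI notI, elim conjE)
    fix a assume p0: "poly p a = 0" and d0: "poly (pderiv p) a = 0"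
    obtain m where m: "n = Suc m" using assms by (cases n) auto
    have "a \<noteq> 0" using p0 assms by (auto simp: poly_p power_0_left)
    have "poly (pderiv p) a = a ^ m * ((of_nat n + 1)^2 * a - of_nat n ^ 2)"
      by (simp add: p_def pderiv_diff pderiv_monom pderiv_1 poly_monom m)
        (simp add: algebra_simps power2_eq_square)
    then have a: "(of_nat n + 1)^2 * a = of_nat n ^ 2" using d0 \<open>a \<noteq> 0\<close> by simp
    \<comment> \<open>The sign argument needs an order, so the critical point is rewritten as a real
      number.\<close>
    define u :: real where "u = real n ^ 2 / (real n + 1) ^ 2"
    have au: "a = of_real u"
      using a n1 by (simp add: u_def field_simps)
    have "of_real (u ^ n * ((real n + 1) * u - real n)) = (1 :: complex)"
      using p0 by (simp add: poly_p au)
    then have eq: "u ^ n * ((real n + 1) * u - real n) = 1" using of_real_eq_1_iff by blast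
    have "(real n + 1) * u - real n = - real n / (real n + 1)"
      by (simp add: u_def power2_eq_square divide_simps) (simp add: algebra_simps)
    then have "(real n + 1) * u - real n \<le> 0" by simp
    moreover have "u ^ n \<ge> 0" by (simp add: u_def)
    ultimately have "u ^ n * ((real n + 1) * u - real n) \<le> 0" by (rule mult_nonneg_nonpos[rotated])
    with eq show False by simp
  qed
  \<comment> \<open>Without multiple roots \<open>p\<close> is a constant times distinct linear
    factors, so its degree counts its roots.\<close>
  then have dec: "smult (lead_coeff p) (\<Prod>z|poly p z = 0. [:-z, 1:]) = p"
    by (rule complex_poly_decompose_rsquarefree)
  have "p \<noteq> 0" using deg by auto
  then have "degree p = degree (\<Prod>z|poly p z = 0. [:-z, 1:])"
    by (subst dec[symmetric]) simp
  also have "\<dots> = card {z. poly p z = 0}"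
    by (subst degree_prod_eq_sum_degree) auto
  finally show ?thesis using deg by (simp add: poly_p)
qed

section \<open>Limit cycles from nontrivial roots\<close>

text \<open>The closed form of \<open>y 0\<close> is recorded because it is injective in
  \<open>\<tau>\<close> and so separates the solutions belonging to different roots.\<close>

lemma limit_cycle_from_root:
  fixes b c \<tau> :: complex
  assumes n: "n \<ge> 1" and c: "c = 1 / 4 * (1 - 1 / (2 * of_nat n + 1) ^ 2)" and "b \<noteq> 0"
    and root: "\<tau> ^ n * ((of_nat n + 1) * \<tau> - of_nat n) = 1" and "\<tau> \<noteq> 1"
  obtains y s g where "local_holomorphic_solution (\<lambda>x y. c * x * y ^ 3 + y ^ 2) 0 y"
    "path s" "pathstart s = 0" "pathfinish s = b" "analytic_continuation_along s y g"
    "y 0 = g b" "y 0 = - (2 * of_nat n + 1) / (b * (of_nat n + 1 + 1 / (\<tau> - 1)))"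
proof -
  obtain m where m: "n = Suc m" using n by (cases n) auto
  define N :: complex where "N = of_nat n"
  have "of_nat (Suc n) \<noteq> (0::complex)" "of_nat (2 * n + 1) \<noteq> (0::complex)"
    unfolding of_nat_eq_0_iff by simp_all
  then have N1: "N + 1 \<noteq> 0" and N2: "2 * N + 1 \<noteq> 0" by (simp_all add: N_def add.commute)
  have root: "\<tau> ^ n * ((N + 1) * \<tau> - N) = 1" using root by (simp add: N_def)
  have "\<tau> \<noteq> 0" using root n by (auto simp: power_0_left)
  have lin\<tau>: "(N + 1) * \<tau> - N \<noteq> 0" using root by auto
  \<comment> \<open>Chosen so that \<open>X \<tau> = b\<close>.\<close>
  define A where "A = b / (\<tau> ^ n * (\<tau> - 1))"
  define L where "L T = (N + 1) * T - N" for T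
  define X where "X T = A * T ^ n * (T - 1)" for T
  define Y where "Y T = - (2 * N + 1) / (A * T ^ n * L T)" for T
  \<comment> \<open>The removed points are the poles of \<open>Y\<close>; \<open>deriv X\<close> can
    vanish only there.\<close>
  define U where "U = - {0, N / (N + 1)}"
  have "A \<noteq> 0" using \<open>b \<noteq> 0\<close> \<open>\<tau> \<noteq> 0\<close> \<open>\<tau> \<noteq> 1\<close> by (simp add: A_def)
  have U: "T \<in> U \<longleftrightarrow> T \<noteq> 0 \<and> L T \<noteq> 0" for T
    using N1 by (auto simp: U_def L_def field_simps)
  have "open U" unfolding U_def by (intro open_Compl finite_imp_closed) auto
  have dX: "(X has_field_derivative A * T ^ m * L T) (at T)" for T
    unfolding X_def by (rule derivative_eq_intros refl | simp add: m N_def L_def algebra_simps)+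
  have dY: "(Y has_field_derivative
      (2 * N + 1) * (N * L T + (N + 1) * T) / (A * T ^ Suc n * L T ^ 2)) (at T)" if "T \<in> U" for T
    using that \<open>A \<noteq> 0\<close> unfolding U Y_def L_def
    apply -
    apply (rule derivative_eq_intros refl | simp)+
    apply (simp add: m N_def divide_simps)
    apply (simp add: algebra_simps power2_eq_square)
    done
  have X: "X holomorphic_on U" and Y: "Y holomorphic_on U"
    using dX dY \<open>open U\<close> holomorphic_on_open by blast+
  have dX0: "deriv X T \<noteq> 0" if "T \<in> U" for T
    using that \<open>A \<noteq> 0\<close> DERIV_imp_deriv[OF dX, of T] by (simp add: U)
  have ode: "deriv Y T / deriv X T = c * X T * Y T ^ 3 + Y T ^ 2" if "T \<in> U" for T
  proof -
    \<comment> \<open>This is the product of the two eigenvalues.\<close>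
    have c': "c = N * (N + 1) / (2 * N + 1) ^ 2"
      using N2 unfolding c N_def[symmetric]
      by (simp add: divide_simps) (simp add: algebra_simps power2_eq_square)
    have [simp]: "T \<noteq> 0" "L T \<noteq> 0" using that by (simp_all add: U)
    \<comment> \<open>Splits the numerator of the quotient of derivatives: the first summand yields
      \<open>c * X T * Y T ^ 3\<close>, the second \<open>Y T ^ 2\<close>.\<close>
    have key: "N * L T + (N + 1) * T = - N * (N + 1) * (T - 1) + (2 * N + 1) * L T"
      by (simp add: L_def algebra_simps)
    have "deriv Y T / deriv X T = (2 * N + 1) * (N * L T + (N + 1) * T) / (A ^ 2 * T ^ n * T ^ n * L T ^ 3)"
      using \<open>A \<noteq> 0\<close> DERIV_imp_deriv[OF dX, of T] DERIV_imp_deriv[OF dY[OF that]]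
      by (simp add: m power2_eq_square power3_eq_cube)
    also have "\<dots> = c * X T * Y T ^ 3 + Y T ^ 2"
    proof -
      have "c * X T * Y T ^ 3 = - N * (N + 1) * (2 * N + 1) * (T - 1) / (A ^ 2 * T ^ n * T ^ n * L T ^ 3)"
        using N2 \<open>A \<noteq> 0\<close> unfolding c' X_def Y_def
        by (simp add: divide_simps) algebra
      moreover have "Y T ^ 2 = (2 * N + 1) * ((2 * N + 1) * L T) / (A ^ 2 * T ^ n * T ^ n * L T ^ 3)"
        using \<open>A \<noteq> 0\<close> unfolding Y_def
        by (simp add: divide_simps) algebra
      ultimately show ?thesis
        unfolding key by (simp add: add_divide_distrib[symmetric] algebra_simps)
    qed
    finally show ?thesis .
  qed
  have "path_connected U"
    unfolding U_def by (intro path_connected_complement_countable) auto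
  moreover have U1: "1 \<in> U" and "\<tau> \<in> U" using lin\<tau> \<open>\<tau> \<noteq> 0\<close> by (simp_all add: U L_def)
  ultimately obtain \<gamma> where \<gamma>: "path \<gamma>" "path_image \<gamma> \<subseteq> U" "pathstart \<gamma> = 1" "pathfinish \<gamma> = \<tau>"
    unfolding path_connected_def by blast
  obtain f g r where fg: "analytic_continuation_along (X \<circ> \<gamma>) f g"
    "r > 0" "ball 1 r \<subseteq> U" "open (X ` ball 1 r)"
    "\<And>T. T \<in> ball 1 r \<Longrightarrow> f (X T) = Y T"
    "\<And>T. T \<in> ball 1 r \<Longrightarrow> (f has_field_derivative deriv Y T / deriv X T) (at (X T))"
    "g (X \<tau>) = Y \<tau>"
    using analytic_continuation_along_compose[OF \<open>open U\<close> X Y dX0 \<gamma>(1,2)] unfolding \<gamma>(3,4) by blast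
  have X1: "X 1 = 0" and X\<tau>: "X \<tau> = b"
    using \<open>\<tau> \<noteq> 0\<close> \<open>\<tau> \<noteq> 1\<close> by (simp_all add: X_def A_def)
  have f0: "f 0 = - (2 * N + 1) / A"
    using fg(5)[of 1] fg(2) X1 by (simp add: Y_def L_def)
  \<comment> \<open>The root equation says that the denominator of \<open>Y\<close> at
    \<open>\<tau>\<close> equals its value \<open>A\<close> at 1.\<close>
  have "A * (\<tau> ^ n * ((N + 1) * \<tau> - N)) = A" using root by simp
  then have "Y \<tau> = - (2 * N + 1) / A" by (simp add: Y_def L_def mult.assoc)
  then have "f 0 = g b" using f0 fg(7) X\<tau> by simp
  \<comment> \<open>Inserting the root equation as a factor 1 cancels \<open>\<tau> ^ n\<close> and
    leaves a Moebius function of \<open>\<tau>\<close>, which is visibly injective.\<close>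
  have "A = b * (\<tau> ^ n * ((N + 1) * \<tau> - N)) / (\<tau> ^ n * (\<tau> - 1))"
    unfolding root by (simp add: A_def)
  also have "\<dots> = b * (N + 1 + 1 / (\<tau> - 1))"
    using \<open>\<tau> \<noteq> 0\<close> \<open>\<tau> \<noteq> 1\<close> by (simp add: field_simps)
  finally have f0': "f 0 = - (2 * of_nat n + 1) / (b * (of_nat n + 1 + 1 / (\<tau> - 1)))"
    using f0 by (simp add: N_def)
  have sol: "(f has_field_derivative c * x * f x ^ 3 + f x ^ 2) (at x)" if "x \<in> X ` ball 1 r" for x
  proof -
    from that obtain T where T: "T \<in> ball 1 r" "x = X T" by blast
    then have "T \<in> U" using fg(3) by blast
    then show ?thesis using fg(6)[OF T(1)] ode fg(5)[OF T(1)] T(2) by simp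
  qed
  have "0 \<in> X ` ball 1 r" using X1 fg(2) by (metis centre_in_ball imageI)
  then obtain e where e: "e > 0" "ball 0 e \<subseteq> X ` ball 1 r"
    using fg(4) open_contains_ball by blast
  have deriv_f: "\<forall>x\<in>ball 0 e. (f has_field_derivative c * x * f x ^ 3 + f x ^ 2) (at x)"
    using sol e(2) by blast
  then have "f holomorphic_on ball 0 e" using holomorphic_on_open[OF open_ball] by blast
  with e(1) deriv_f have "local_holomorphic_solution (\<lambda>x y. c * x * y ^ 3 + y ^ 2) 0 f"
    unfolding local_holomorphic_solution_def by blast
  moreover have "path (X \<circ> \<gamma>)"
    using \<gamma>(1,2) X by (meson path_continuous_image holomorphic_on_imp_continuous_on continuous_on_subset)
  moreover have "pathstart (X \<circ> \<gamma>) = 0" "pathfinish (X \<circ> \<gamma>) = b"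
    using \<gamma>(3,4) X1 X\<tau> by (simp_all add: pathstart_compose pathfinish_compose)
  ultimately show ?thesis using that fg(1) \<open>f 0 = g b\<close> f0' by blast
qed

theorem theorem5p1:
  fixes n :: nat and b c :: complex
  assumes "n \<ge> 1"
    and "c = 1 / 4 * (1 - 1 / (2 * of_nat n + 1) ^ 2)"
    and "b \<noteq> 0"
  shows "\<exists>(y :: nat \<Rightarrow> complex \<Rightarrow> complex) (s :: nat \<Rightarrow> real \<Rightarrow> complex).
      (\<forall>j\<in>{1..n}. local_holomorphic_solution (\<lambda>x y. c * x * y ^ 3 + y ^ 2) 0 (y j)) \<and>
      (\<forall>i\<in>{1..n}. \<forall>j\<in>{1..n}. i \<noteq> j \<longrightarrow> \<not> same_germ 0 (y i) (y j)) \<and>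
      (\<forall>j\<in>{1..n}. path (s j) \<and> pathstart (s j) = 0 \<and> pathfinish (s j) = b \<and>
         (\<exists>g. analytic_continuation_along (s j) (y j) g \<and> y j 0 = g b))"
proof -
  define R where "R = {T::complex. T ^ n * ((of_nat n + 1) * T - of_nat n) = 1}"
  have "card R = Suc n" unfolding R_def by (rule card_parameter_equation_roots[OF assms(1)])
  \<comment> \<open>The root 1 is discarded: its endpoint would be 0 instead of
    \<open>b\<close>.\<close>
  moreover have "1 \<in> R" by (simp add: R_def)
  ultimately have "card (R - {1}) = n" "finite (R - {1})"
    using card.infinite by fastforce+
  then obtain \<tau> where \<tau>: "bij_betw \<tau> {1..n} (R - {1})"
    using ex_bij_betw_nat_finite_1 by metis
  define P where "P j y s \<longleftrightarrow> local_holomorphic_solution (\<lambda>x y. c * x * y ^ 3 + y ^ 2) 0 y \<and>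
      path s \<and> pathstart s = 0 \<and> pathfinish s = b \<and>
      (\<exists>g. analytic_continuation_along s y g \<and> y 0 = g b) \<and>
      y 0 = - (2 * of_nat n + 1) / (b * (of_nat n + 1 + 1 / (\<tau> j - 1)))" for j y s
  have "\<exists>y s. P j y s" if "j \<in> {1..n}" for j
  proof -
    have "\<tau> j \<in> R - {1}" using \<tau> that by (auto dest: bij_betwE)
    then have root: "\<tau> j ^ n * ((of_nat n + 1) * \<tau> j - of_nat n) = 1" and "\<tau> j \<noteq> 1"
      by (simp_all add: R_def)
    obtain y s g where "local_holomorphic_solution (\<lambda>x y. c * x * y ^ 3 + y ^ 2) 0 y"
      "path s" "pathstart s = 0" "pathfinish s = b" "analytic_continuation_along s y g"
      "y 0 = g b" "y 0 = - (2 * of_nat n + 1) / (b * (of_nat n + 1 + 1 / (\<tau> j - 1)))"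
      by (rule limit_cycle_from_root[OF assms root \<open>\<tau> j \<noteq> 1\<close>])
    then have "P j y s" unfolding P_def by (intro conjI exI[of _ g])
    then show ?thesis by blast
  qed
  then obtain y s where P: "\<And>j. j \<in> {1..n} \<Longrightarrow> P j (y j) (s j)"
    by metis
  have "\<not> same_germ 0 (y i) (y j)" if ij: "i \<in> {1..n}" "j \<in> {1..n}" "i \<noteq> j" for i j
  proof
    assume "same_germ 0 (y i) (y j)"
    then have "y i 0 = y j 0" unfolding same_germ_def by (rule eventually_nhds_x_imp_x)
    moreover have "y k 0 = - (2 * of_nat n + 1) / (b * (of_nat n + 1 + 1 / (\<tau> k - 1)))"
      if "k \<in> {1..n}" for k
      using P[OF that] by (simp add: P_def)
    ultimately have "- (2 * of_nat n + 1) / (b * (of_nat n + 1 + 1 / (\<tau> i - 1))) =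
        - (2 * of_nat n + 1) / (b * (of_nat n + 1 + 1 / (\<tau> j - 1)))"
      using ij by metis
    \<comment> \<open>The common numerator is nonzero, so the denominators can be compared;
      \<open>inverse\<close> is injective even at 0, as \<open>inverse 0 = 0\<close>.\<close>
    moreover have "of_nat (2 * n + 1) \<noteq> (0::complex)" unfolding of_nat_eq_0_iff by simp
    then have "- (2 * of_nat n + 1 :: complex) \<noteq> 0"
      unfolding neg_equal_0_iff_equal by (simp add: add.commute)
    ultimately have "b * (of_nat n + 1 + 1 / (\<tau> i - 1)) = b * (of_nat n + 1 + 1 / (\<tau> j - 1))"
      unfolding divide_cancel_left by blast
    then have "\<tau> i = \<tau> j" using \<open>b \<noteq> 0\<close> by simp
    then show False using inj_onD[OF bij_betw_imp_inj_on[OF \<tau>]] ij by blast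
  qed
  then show ?thesis using P unfolding P_def by (intro exI[of _ y] exI[of _ s] conjI ballI impI) blast+
qed

end
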